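(* For any integers $m\geq1$ and $k\geq0$ there exist rational numbers $d_0,\dots,d_k$ such that for all $y>0$, \[ S_{2(m+k),2k+2}(y)=\sum_{j=0}^k d_j\frac{d^{2j}}{dy^{2j}}\Big(S_{2(m+k-j),2}(y)\Big). \]
   Context: For integers $p$ and $m\ge1$ and real $y>0$, $S_{p,m}(y)=\sum_{n=1}^\infty\frac{n^p}{\sinh^m(ny)}$. *)

theory Defs
  imports "HOL-Analysis.Analysis"
begin

text \<open>The sum over \<open>n \<ge> 1\<close> is indexed from \<open>0\<close> by shifting; the exponent \<open>p\<close> may be negative,
  whence \<open>powi\<close>. Only the values at \<open>y > 0\<close>, where the series converges if \<open>m \<ge> 1\<close>, are meaningful.\<close>

definition S :: "int \<Rightarrow> nat \<Rightarrow> real \<Rightarrow> real" where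
  "S p m y = (\<Sum>n. real (Suc n) powi p / sinh (real (Suc n) * y) ^ m)"

end

theory Submission
  imports Defs "HOL-Real_Asymp.Real_Asymp"
begin

text \<open>The function \<open>f = sinh powi (-s)\<close> satisfies \<open>f'' = s\<^sup>2 f + s (s + 1) sinh powi (-s - 2)\<close>.
  Replacing the argument by \<open>n y\<close> and summing over \<open>n\<close> turns this into
  \<open>S\<^sub>p\<^sub>,\<^sub>s'' = s\<^sup>2 S\<^sub>p\<^sub>+\<^sub>2\<^sub>,\<^sub>s + s (s + 1) S\<^sub>p\<^sub>+\<^sub>2\<^sub>,\<^sub>s\<^sub>+\<^sub>2\<close>, which is solved for the last
  term and iterated from \<open>s = 2\<close>. Termwise differentiation is justified by the exponential decay of
  the terms, locally uniformly in \<open>y > 0\<close>.\<close>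

section \<open>Hyperbolic series and their convergence\<close>

definition hyp_term :: "int \<Rightarrow> nat \<Rightarrow> nat \<Rightarrow> nat \<Rightarrow> real \<Rightarrow> real" where
  "hyp_term p a m n y =
    real (Suc n) powi p * cosh (real (Suc n) * y) ^ a / sinh (real (Suc n) * y) ^ m"

definition hyp_series :: "int \<Rightarrow> nat \<Rightarrow> nat \<Rightarrow> real \<Rightarrow> real" where
  "hyp_series p a m y = (\<Sum>n. hyp_term p a m n y)"

lemma S_eq_hyp_series: "S p m = hyp_series p 0 m"
  by (simp add: fun_eq_iff S_def hyp_series_def hyp_term_def)

lemma summable_powi_div_sinh:
  fixes c :: real
  assumes "c > 0"
  shows "summable (\<lambda>n. real (Suc n) powi p / sinh (real (Suc n) * c))"
proof (rule summable_comparison_test_bigo)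
  show "summable (\<lambda>n. norm (1 / real n ^ 2))"
    using inverse_power_summable[of 2, where 'a = real] by (simp add: divide_inverse)
  \<comment> \<open>The asymptotics are proved for an arbitrary real exponent \<open>q\<close> in
    \<open>powr\<close> form, with \<open>sinh\<close> unfolded into exponentials; specialising
    \<open>q\<close> to an integer returns to \<open>powi\<close>.\<close>
  have "(\<lambda>n. real (Suc n) powr q / sinh (real (Suc n) * c)) \<in> O(\<lambda>n. 1 / real n ^ 2)" for q
    unfolding sinh_field_def using assms by real_asymp
  from this[of "of_int p"]
  show "(\<lambda>n. real (Suc n) powi p / sinh (real (Suc n) * c)) \<in> O(\<lambda>n. 1 / real n ^ 2)"
    by (simp add: powr_real_of_int')
qed

text \<open>The majorant must not depend on \<open>x\<close>. Each \<open>cosh\<close> is paired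
  with a \<open>sinh\<close> to form a \<open>coth\<close>, bounded since
  \<open>cosh z - sinh z = exp (- z)\<close> is at most 1. As \<open>a < m\<close>, at least one
  factor \<open>1 / sinh\<close> remains; it supplies the decay in \<open>n\<close>, and any further
  ones are bounded by \<open>1 / sinh c\<close>.\<close>

lemma norm_hyp_term_le:
  fixes c x :: real
  assumes "0 < c" "c \<le> x" "a < m"
  shows "norm (hyp_term p a m n x) \<le>
    (1 + 1 / sinh c) ^ a * (1 / sinh c) ^ (m - a - 1) *
      (real (Suc n) powi p / sinh (real (Suc n) * c))"
proof -
  define z where "z = real (Suc n) * x"
  define w where "w = real (Suc n) * c"
  have "c \<le> w" using assms by (simp add: w_def)
  have "w \<le> z" using assms by (simp add: w_def z_def)
  have pos: "sinh c > 0" "sinh w > 0" "sinh z > 0" "cosh z > 0"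
    using assms \<open>c \<le> w\<close> \<open>w \<le> z\<close> by auto
  have le: "sinh c \<le> sinh w" "sinh w \<le> sinh z"
    using \<open>c \<le> w\<close> \<open>w \<le> z\<close> by auto
  have "cosh z \<le> sinh z + 1"
    using cosh_minus_sinh[of z] exp_le_one_iff[of "- z"] assms \<open>c \<le> w\<close> \<open>w \<le> z\<close> by linarith
  then have "cosh z / sinh z \<le> 1 + 1 / sinh z"
    using pos by (simp add: field_simps)
  also have "\<dots> \<le> 1 + 1 / sinh c"
    using pos le by (simp add: frac_le)
  finally have coth: "cosh z / sinh z \<le> 1 + 1 / sinh c" .
  obtain r where r: "m = a + Suc r"
    using assms(3) less_iff_Suc_add by auto
  have "norm (hyp_term p a m n x) =
      real (Suc n) powi p * ((cosh z / sinh z) ^ a * ((1 / sinh z) ^ r * (1 / sinh z)))"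
    using pos by (simp add: hyp_term_def z_def[symmetric] r power_add power_divide abs_mult
        del: of_nat_Suc)
  also have "\<dots> \<le> real (Suc n) powi p * ((1 + 1 / sinh c) ^ a * ((1 / sinh c) ^ r * (1 / sinh w)))"
    using pos le coth by (intro mult_left_mono mult_mono power_mono) (auto intro!: frac_le)
  finally show ?thesis
    by (simp add: r w_def mult_ac)
qed

lemma summable_hyp_term:
  assumes "y > 0" "a < m"
  shows "summable (\<lambda>n. hyp_term p a m n y)"
  by (rule summable_comparison_test'[OF summable_mult[OF summable_powi_div_sinh[OF assms(1)]]])
    (rule norm_hyp_term_le[OF assms(1) order_refl assms(2)])

section \<open>Termwise differentiation\<close>

lemma uniformly_convergent_hyp_series:
  assumes "c > 0" "a < m"
  shows "uniformly_convergent_on {c<..} (\<lambda>N x. \<Sum>n<N. hyp_term p a m n x)"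
  by (rule Weierstrass_m_test'[OF _ summable_mult[OF summable_powi_div_sinh[OF assms(1)]]])
    (rule norm_hyp_term_le; use assms in simp)

lemma has_real_derivative_hyp_term:
  assumes "y > 0" "m > 0"
  shows "(hyp_term p a m n has_real_derivative
    real a * hyp_term (p + 1) (a - 1) (m - 1) n y
      - real m * hyp_term (p + 1) (a + 1) (m + 1) n y) (at y within A)"
proof -
  define N where "N = real (Suc n)"
  have N: "N > 0" by (simp add: N_def)
  have s: "sinh (N * y) > 0" using N assms by simp
  have powi: "N powi (p + 1) = N powi p * N"
    using N by (simp add: power_int_add_1)
  show ?thesis
    unfolding hyp_term_def N_def[symmetric]
  proof (rule DERIV_cong)
    show "((\<lambda>y. N powi p * cosh (N * y) ^ a / sinh (N * y) ^ m) has_real_derivative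
        (N powi p * (real a * cosh (N * y) ^ (a - 1) * (sinh (N * y) * N)) * sinh (N * y) ^ m
          - N powi p * cosh (N * y) ^ a * (real m * sinh (N * y) ^ (m - 1) * (cosh (N * y) * N)))
        / (sinh (N * y) ^ m * sinh (N * y) ^ m)) (at y within A)" (is "(_ has_real_derivative ?D) _")
      using s by (auto intro!: derivative_eq_intros)
    obtain r where "m = Suc r"
      using assms(2) gr0_implies_Suc by blast
    then show "?D = real a * (N powi (p + 1) * cosh (N * y) ^ (a - 1) / sinh (N * y) ^ (m - 1))
        - real m * (N powi (p + 1) * cosh (N * y) ^ (a + 1) / sinh (N * y) ^ (m + 1))"
      using s assms(1) by (simp add: powi diff_divide_distrib mult_ac)
  qed
qed

lemma has_real_derivative_hyp_series:
  assumes "y > 0" "a < m"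
  shows "(hyp_series p a m has_real_derivative
    real a * hyp_series (p + 1) (a - 1) (m - 1) y
      - real m * hyp_series (p + 1) (a + 1) (m + 1) y) (at y)"
proof -
  define T where "T n x = real a * hyp_term (p + 1) (a - 1) (m - 1) n x
      - real m * hyp_term (p + 1) (a + 1) (m + 1) n x" for n x
  \<comment> \<open>Any \<open>c\<close> strictly between 0 and \<open>y\<close> would do:
    \<open>{c<..}\<close> is an open neighbourhood of \<open>y\<close> on which the majorant is
    uniform.\<close>
  define c where "c = y / 2"
  have c: "c > 0" "y \<in> {c<..}" using assms by (auto simp: c_def)
  have "uniformly_convergent_on {c<..} (\<lambda>N x. real a * (\<Sum>n<N. hyp_term (p + 1) (a - 1) (m - 1) n x))"
  \<comment> \<open>For \<open>a = 0\<close> the truncated \<open>a - 1\<close> is 0, and with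
    \<open>m = 1\<close> the series at \<open>a - 1\<close>, \<open>m - 1\<close> is a bare sum of
    powers that may diverge; the factor \<open>real a = 0\<close> removes it.\<close>
  proof (cases "a = 0")
    case False
    then show ?thesis
      using assms c
      by (intro bounded_linear.uniformly_convergent_on[OF bounded_linear_mult_right]
            uniformly_convergent_hyp_series) auto
  qed simp
  moreover have "uniformly_convergent_on {c<..} (\<lambda>N x. real m * (\<Sum>n<N. hyp_term (p + 1) (a + 1) (m + 1) n x))"
    using assms c
    by (intro bounded_linear.uniformly_convergent_on[OF bounded_linear_mult_right]
            uniformly_convergent_hyp_series) auto
  ultimately have "uniformly_convergent_on {c<..} (\<lambda>N x. \<Sum>n<N. T n x)"
    unfolding T_def sum_subtractf sum_distrib_left[symmetric] by (rule uniformly_convergent_minus)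
  then have "((\<lambda>x. \<Sum>n. hyp_term p a m n x) has_real_derivative (\<Sum>n. T n y)) (at y)"
    using c assms unfolding T_def
    by (intro has_field_derivative_series'(2)[where S = "{c<..}" and ?x0.0 = y]
          has_real_derivative_hyp_term summable_hyp_term) (auto simp: interior_open)
  moreover have "(\<lambda>n. real a * hyp_term (p + 1) (a - 1) (m - 1) n y) sums
      (real a * hyp_series (p + 1) (a - 1) (m - 1) y)"
    using assms unfolding hyp_series_def
    by (cases "a = 0") (auto intro!: sums_mult summable_hyp_term)
  moreover have "(\<lambda>n. real m * hyp_term (p + 1) (a + 1) (m + 1) n y) sums
      (real m * hyp_series (p + 1) (a + 1) (m + 1) y)"
    using assms unfolding hyp_series_def
    by (auto intro!: sums_mult summable_hyp_term)
  ultimately show ?thesis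
    unfolding T_def hyp_series_def[of p a m, abs_def] by (simp only: sums_diff[THEN sums_unique, symmetric])
qed

section \<open>A function class closed under differentiation\<close>

inductive_set hyp_span :: "(real \<Rightarrow> real) set" where
  series: "a < m \<Longrightarrow> hyp_series p a m \<in> hyp_span"
| lin: "f \<in> hyp_span \<Longrightarrow> g \<in> hyp_span \<Longrightarrow> (\<lambda>y. u * f y + v * g y) \<in> hyp_span"

text \<open>Differentiation moves \<open>a\<close> and \<open>m\<close> up or down together, so the
  gap \<open>m - a\<close>, and with it convergence, is preserved.\<close>

lemma hyp_span_derivative:
  assumes "f \<in> hyp_span"
  shows "\<exists>g\<in>hyp_span. \<forall>y>0. (f has_real_derivative g y) (at y)"
  using assms
proof induction
  case (series a m p)
  let ?h = "hyp_series (p + 1) (a + 1) (m + 1)"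
  have h: "?h \<in> hyp_span"
    using series by (intro hyp_span.series) simp
  show ?case
  proof (cases "a = 0")
    case True
    then show ?thesis
      using has_real_derivative_hyp_series[OF _ series, of _ p]
      \<comment> \<open>Only one series survives here; \<open>lin\<close> combines two members, so
        \<open>?h\<close> is taken twice, once with coefficient 0.\<close>
      by (intro bexI[OF _ hyp_span.lin[OF h h, of "- real m" 0]]) simp
  next
    case False
    then have "hyp_series (p + 1) (a - 1) (m - 1) \<in> hyp_span"
      using series by (intro hyp_span.series) simp
    then show ?thesis
      using has_real_derivative_hyp_series[OF _ series, of _ p]
      by (intro bexI[OF _ hyp_span.lin[OF _ h, of _ "real a" "- real m"]]) simp_all
  qed
next
  case (lin f g u v)
  then obtain f' g' where "f' \<in> hyp_span" "g' \<in> hyp_span"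
    and d: "\<forall>y>0. (f has_real_derivative f' y) (at y)" "\<forall>y>0. (g has_real_derivative g' y) (at y)"
    by blast
  then show ?case
    by (intro bexI[OF _ hyp_span.lin[of f' g' u v]]) (auto intro!: derivative_eq_intros)
qed

text \<open>Identities between the series are available only for positive arguments; this suffices
  for derivatives because the half-line is open.\<close>

lemma deriv_cong_pos:
  fixes f g :: "real \<Rightarrow> real"
  assumes "\<And>y. y > 0 \<Longrightarrow> f y = g y" "x > 0"
  shows "deriv f x = deriv g x"
  by (rule deriv_cong_ev[OF eventually_mono[OF eventually_nhds_in_open[of "{0<..}"]]])
    (use assms in auto)

lemma hyp_span_higher_deriv:
  assumes "f \<in> hyp_span"
  shows "\<exists>g\<in>hyp_span. \<forall>y>0. (deriv ^^ i) f y = g y"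
proof (induction i)
  case (Suc i)
  then obtain g where g: "g \<in> hyp_span" "\<And>y. y > 0 \<Longrightarrow> (deriv ^^ i) f y = g y"
    by blast
  obtain h where "h \<in> hyp_span" "\<And>y. y > 0 \<Longrightarrow> (g has_real_derivative h y) (at y)"
    using hyp_span_derivative[OF g(1)] by blast
  then show ?case
    using deriv_cong_pos[OF g(2)] by (auto intro!: bexI[of _ h] DERIV_imp_deriv)
qed (use assms in auto)

text \<open>\<open>deriv\<close> is a total operator, so its linearity over finite sums requires
  genuine differentiability of every iterate.\<close>

lemma higher_deriv_has_derivative:
  assumes "f \<in> hyp_span" "y > 0"
  shows "((deriv ^^ i) f has_real_derivative (deriv ^^ Suc i) f y) (at y)"
proof -
  obtain g where g: "g \<in> hyp_span" "\<And>y. y > 0 \<Longrightarrow> (deriv ^^ i) f y = g y"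
    using hyp_span_higher_deriv[OF assms(1)] by blast
  obtain h where h: "(g has_real_derivative h y) (at y)"
    using hyp_span_derivative[OF g(1)] assms(2) by blast
  have ev: "eventually (\<lambda>x. (deriv ^^ i) f x = g x) (nhds y)"
    by (rule eventually_mono[OF eventually_nhds_in_open[of "{0<..}"]]) (use g assms(2) in auto)
  have "((deriv ^^ i) f has_real_derivative h y) (at y)"
    using h DERIV_cong_ev[OF refl ev refl] by blast
  then show ?thesis
    by (simp add: DERIV_imp_deriv)
qed

lemma deriv_sum_higher_deriv:
  assumes "\<And>j. j \<in> J \<Longrightarrow> f j \<in> hyp_span" "y > 0"
  shows "deriv (\<lambda>y. \<Sum>j\<in>J. c j * (deriv ^^ i j) (f j) y) y
    = (\<Sum>j\<in>J. c j * (deriv ^^ Suc (i j)) (f j) y)"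
  by (intro DERIV_imp_deriv DERIV_sum DERIV_cmult higher_deriv_has_derivative assms)

lemma S_in_hyp_span: "m > 0 \<Longrightarrow> S p m \<in> hyp_span"
  by (simp add: S_eq_hyp_series hyp_span.series)

section \<open>The recurrence and its iteration\<close>

lemma deriv_deriv_S:
  assumes "m > 0" "y > 0"
  shows "deriv (deriv (S p m)) y =
    (real m)\<^sup>2 * S (p + 2) m y + real m * (real m + 1) * S (p + 2) (m + 2) y"
proof -
  have "deriv (S p m) x = - real m * hyp_series (p + 1) 1 (m + 1) x" if "x > 0" for x
    using has_real_derivative_hyp_series[OF that assms(1), of p]
    by (simp add: S_eq_hyp_series DERIV_imp_deriv)
  then have "deriv (deriv (S p m)) y = deriv (\<lambda>x. - real m * hyp_series (p + 1) 1 (m + 1) x) y"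
    using assms(2) by (rule deriv_cong_pos)
  also have "\<dots> = - real m * (S (p + 2) m y - real (m + 1) * hyp_series (p + 2) 2 (m + 2) y)"
    using DERIV_cmult[OF has_real_derivative_hyp_series[of y 1 "m + 1" "p + 1"], of "- real m"] assms
    by (intro DERIV_imp_deriv) (simp add: S_eq_hyp_series add.assoc numeral_2_eq_2)
  \<comment> \<open>Termwise this is \<open>cosh\<^sup>2 = sinh\<^sup>2 + 1\<close>, which
    eliminates \<open>cosh\<close> and leaves two series of the original type.\<close>
  also have "hyp_series (p + 2) 2 (m + 2) y = S (p + 2) m y + S (p + 2) (m + 2) y"
  proof -
    have "hyp_term (p + 2) 2 (m + 2) n y = hyp_term (p + 2) 0 m n y + hyp_term (p + 2) 0 (m + 2) n y" for n
    proof -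
      have "sinh (real (Suc n) * y) \<noteq> 0" using assms by simp
      then show ?thesis
        unfolding hyp_term_def cosh_square_eq by (simp add: field_simps power_add power2_eq_square)
    qed
    then show ?thesis
      unfolding S_eq_hyp_series hyp_series_def
      using assms by (simp add: suminf_add[symmetric] summable_hyp_term)
  qed
  finally show ?thesis
    by (simp add: algebra_simps power2_eq_square)
qed

text \<open>The coefficients are chosen before \<open>p\<close>: the induction step uses the same
  \<open>d\<close> both at \<open>p\<close> and, differentiated twice, at
  \<open>p - 2\<close>.\<close>

lemma S_even_expansion:
  "\<exists>d :: nat \<Rightarrow> rat. \<forall>p y. y > 0 \<longrightarrow> S p (2 * k + 2) y =
    (\<Sum>j=0..k. real_of_rat (d j) * (deriv ^^ (2 * j)) (S (p - 2 * int j) 2) y)"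
proof (induction k)
  case 0
  show ?case by (rule exI[of _ "\<lambda>_. 1"]) (simp add: numeral_2_eq_2)
next
  case (Suc k)
  then obtain d :: "nat \<Rightarrow> rat" where d: "\<And>p y. y > 0 \<Longrightarrow> S p (2 * k + 2) y =
    (\<Sum>j=0..k. real_of_rat (d j) * (deriv ^^ (2 * j)) (S (p - 2 * int j) 2) y)"
    by blast
  define s :: rat where "s = of_nat (2 * k + 2)"
  have s: "real_of_rat s = real (2 * k + 2)" "real_of_rat s > 0"
    by (simp_all add: s_def of_rat_add of_rat_mult)
  \<comment> \<open>Coefficients of the recurrence solved for its last term, with
    \<open>s = 2 * k + 2\<close>. Two derivatives shift the index by one, hence
    \<open>d (j - 1)\<close>; the two conditionals pad both expansions with zeros to the common
    range \<open>0..Suc k\<close>.\<close>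
  define e where "e j = ((if j = 0 then 0 else d (j - 1)) - s\<^sup>2 * (if j \<le> k then d j else 0))
      / (s * (s + 1))" for j
  show ?case
  proof (intro exI[of _ e] allI impI)
    fix p :: int and y :: real
    assume y: "y > 0"
    define D where "D j = (deriv ^^ (2 * j)) (S (p - 2 * int j) 2) y" for j
    have "deriv (S (p - 2) (2 * k + 2)) x =
        (\<Sum>j=0..k. real_of_rat (d j) * (deriv ^^ Suc (2 * j)) (S (p - 2 - 2 * int j) 2) x)"
      if "x > 0" for x
      using deriv_cong_pos[OF d that] that
      by (simp only: deriv_sum_higher_deriv S_in_hyp_span zero_less_numeral)
    from deriv_cong_pos[OF this y]
    have "deriv (deriv (S (p - 2) (2 * k + 2))) y =
        (\<Sum>j=0..k. real_of_rat (d j) * (deriv ^^ Suc (Suc (2 * j))) (S (p - 2 - 2 * int j) 2) y)"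
      using y by (simp only: deriv_sum_higher_deriv S_in_hyp_span zero_less_numeral)
    \<comment> \<open>Starting from \<open>p - 2\<close> pays off here:
      \<open>p - 2 - 2 * int j\<close> equals \<open>p - 2 * int (Suc j)\<close>, so order and
      weight both fit \<open>D (Suc j)\<close>.\<close>
    also have "\<dots> = (\<Sum>j=0..k. real_of_rat (d j) * D (Suc j))"
      unfolding D_def by (intro sum.cong refl) (simp add: algebra_simps)
    also have "\<dots> = (\<Sum>j=0..Suc k. real_of_rat (if j = 0 then 0 else d (j - 1)) * D j)"
      by (subst sum.atLeast0_atMost_Suc_shift) simp
    finally have A: "deriv (deriv (S (p - 2) (2 * k + 2))) y = \<dots>" .
    have B: "S p (2 * k + 2) y = (\<Sum>j=0..Suc k. real_of_rat (if j \<le> k then d j else 0) * D j)"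
      using d[OF y, of p] by (simp add: D_def)
    have "real_of_rat s * (real_of_rat s + 1) * S p (2 * Suc k + 2) y =
        deriv (deriv (S (p - 2) (2 * k + 2))) y - (real_of_rat s)\<^sup>2 * S p (2 * k + 2) y"
      using deriv_deriv_S[of "2 * k + 2" y "p - 2"] y by (simp add: s)
    also have "\<dots> = (\<Sum>j=0..Suc k. (real_of_rat s * (real_of_rat s + 1)) * (real_of_rat (e j) * D j))"
      unfolding A B sum_distrib_left sum_subtractf[symmetric]
      using s(2)
      by (intro sum.cong refl)
        (simp add: e_def of_rat_diff of_rat_mult of_rat_divide of_rat_add of_rat_power
           left_diff_distrib add_pos_pos less_imp_neq[symmetric] del: of_nat_Suc)
    finally show "S p (2 * Suc k + 2) y =
        (\<Sum>j=0..Suc k. real_of_rat (e j) * (deriv ^^ (2 * j)) (S (p - 2 * int j) 2) y)"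
      using s(2) unfolding sum_distrib_left[symmetric] D_def by simp
  qed
qed

theorem theorem4p11:
  fixes m k :: nat
  assumes "m \<ge> 1"
  shows "\<exists>d :: nat \<Rightarrow> rat. \<forall>y::real. y > 0 \<longrightarrow>
    S (2 * (int m + int k)) (2 * k + 2) y =
      (\<Sum>j=0..k. real_of_rat (d j) * (deriv ^^ (2 * j)) (S (2 * (int m + int k - int j)) 2) y)"
proof -
  \<comment> \<open>Matches the weights with \<open>p - 2 * int j\<close> at
    \<open>p = 2 * (int m + int k)\<close>.\<close>
  have "2 * (int m + int k - int j) = 2 * (int m + int k) - 2 * int j" for j
    by simp
  moreover obtain d :: "nat \<Rightarrow> rat" where
    "\<And>p y. y > 0 \<Longrightarrow> S p (2 * k + 2) y =
      (\<Sum>j=0..k. real_of_rat (d j) * (deriv ^^ (2 * j)) (S (p - 2 * int j) 2) y)"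
    using S_even_expansion[of k] by blast
  ultimately show ?thesis
    by (intro exI[of _ d]) simp
qed

end
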